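(* Let $0<p<1$ be a constant and let $F$ be a graph (without isolated vertices) with property $(\ntriangleright)$. Then there is a constant $C=C(F,p)>0$ such that with probability tending to $1$ as $n\to\infty$, $\mathrm{sat}\left(G(n,p),F\right)\le Cn$, i.e. with high probability $\mathrm{sat}(G(n,p),F)=O(n)$.
   Context: $G(n,p)$ is the binomial random graph on $[n]$ with edge probability $p$. For graphs $G,F$, a subgraph $H\subseteq G$ is $F$-saturated in $G$ if $H$ contains no copy of $F$, but adding any edge of $E(G)\setminus E(H)$ creates a copy of $F$; $\mathrm{sat}(G,F)$ is the minimum number of edges of an $F$-saturated subgraph of $G$. Let $\chi(F)$ be the chromatic number of $F$. A graph $F$ has property $(\ntriangleright)$ if there exist a colour class $I_{\max}$ which has the largest size among all colour classes of all proper colourings of $F$ with $\chi(F)$ colours, and a vertex $v\in V(F)\setminus I_{\max}$ such that $N_F(v)\subseteq I_{\max}$. (Every bipartite graph has this property.) *)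

theory Defs
  imports "HOL-Probability.Probability"
begin

datatype 'a ugraph = UGraph (verts: "'a set") (edges: "'a set set")

definition simple_graph :: "'a ugraph \<Rightarrow> bool" where
  "simple_graph G \<longleftrightarrow> finite (verts G) \<and> edges G \<subseteq> {e. e \<subseteq> verts G \<and> card e = 2}"

definition subgraph :: "'a ugraph \<Rightarrow> 'a ugraph \<Rightarrow> bool" where
  "subgraph H G \<longleftrightarrow> simple_graph H \<and> verts H \<subseteq> verts G \<and> edges H \<subseteq> edges G"

definition nbhd :: "'a ugraph \<Rightarrow> 'a \<Rightarrow> 'a set" where
  "nbhd G v = {u. {v, u} \<in> edges G}"

definition no_isolated_vertices :: "'a ugraph \<Rightarrow> bool" where
  "no_isolated_vertices G \<longleftrightarrow> (\<forall>v\<in>verts G. nbhd G v \<noteq> {})"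

text \<open>Copies are not required to be induced.\<close>

definition contains_copy :: "'a ugraph \<Rightarrow> 'b ugraph \<Rightarrow> bool" where
  "contains_copy H F \<longleftrightarrow>
     (\<exists>f. inj_on f (verts F) \<and> f ` verts F \<subseteq> verts H \<and> (\<forall>e\<in>edges F. f ` e \<in> edges H))"

definition add_edge :: "'a ugraph \<Rightarrow> 'a set \<Rightarrow> 'a ugraph" where
  "add_edge H e = UGraph (verts H \<union> e) (insert e (edges H))"

definition saturated_in :: "'a ugraph \<Rightarrow> 'a ugraph \<Rightarrow> 'b ugraph \<Rightarrow> bool" where
  "saturated_in H G F \<longleftrightarrow>
     subgraph H G \<and> \<not> contains_copy H F \<and>
     (\<forall>e \<in> edges G - edges H. contains_copy (add_edge H e) F)"

text \<open>The minimum is attained whenever F has an edge: see \<open>saturated_in_exists\<close>.\<close>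

definition sat :: "'a ugraph \<Rightarrow> 'b ugraph \<Rightarrow> nat" where
  "sat G F = (LEAST m. \<exists>H. saturated_in H G F \<and> card (edges H) = m)"

definition proper_colouring :: "'a ugraph \<Rightarrow> nat \<Rightarrow> ('a \<Rightarrow> nat) \<Rightarrow> bool" where
  "proper_colouring G k c \<longleftrightarrow>
     c ` verts G \<subseteq> {..<k} \<and> (\<forall>u v. {u, v} \<in> edges G \<longrightarrow> c u \<noteq> c v)"

definition chromatic_number :: "'a ugraph \<Rightarrow> nat" where
  "chromatic_number G = (LEAST k. \<exists>c. proper_colouring G k c)"

definition optimal_colour_classes :: "'a ugraph \<Rightarrow> 'a set set" where
  "optimal_colour_classes G =
     {{v \<in> verts G. c v = i} | c i. proper_colouring G (chromatic_number G) c \<and> i < chromatic_number G}"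

definition ntriangleright :: "'a ugraph \<Rightarrow> bool" where
  "ntriangleright F \<longleftrightarrow>
     (\<exists>I \<in> optimal_colour_classes F.
        (\<forall>J \<in> optimal_colour_classes F. card J \<le> card I) \<and>
        (\<exists>v \<in> verts F - I. nbhd F v \<subseteq> I))"

definition pairs :: "nat \<Rightarrow> nat set set" where
  "pairs n = {e. e \<subseteq> {1..n} \<and> card e = 2}"

definition gnp :: "nat \<Rightarrow> real \<Rightarrow> nat ugraph pmf" where
  "gnp n p = map_pmf (\<lambda>b. UGraph {1..n} {e \<in> pairs n. b e})
               (Pi_pmf (pairs n) False (\<lambda>_. bernoulli_pmf p))"

lemma saturated_in_exists:
  assumes G: "simple_graph G" and F: "edges F \<noteq> {}"
  shows "\<exists>H. saturated_in H G F"
proof -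
  let ?S = "{E. E \<subseteq> edges G \<and> \<not> contains_copy (UGraph (verts G) E) F}"
  have "edges G \<subseteq> Pow (verts G)" "finite (verts G)"
    using G by (auto simp: simple_graph_def)
  then have "finite (edges G)"
    by (meson finite_Pow_iff finite_subset)
  then have fin: "finite ?S" by simp
  have "{} \<in> ?S" using F by (auto simp: contains_copy_def)
  then obtain E where E: "E \<in> ?S" and max: "\<forall>D\<in>?S. E \<subseteq> D \<longrightarrow> E = D"
    using finite_has_maximal[OF fin] by blast
  have "contains_copy (add_edge (UGraph (verts G) E) e) F" if e: "e \<in> edges G - E" for e
  proof -
    have "verts G \<union> e = verts G" using e G by (auto simp: simple_graph_def)
    moreover have "insert e E \<notin> ?S" using max e by blast
    ultimately show ?thesis using e E by (auto simp: add_edge_def)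
  qed
  then have "saturated_in (UGraph (verts G) E) G F"
    using E G by (auto simp: saturated_in_def subgraph_def simple_graph_def)
  then show ?thesis ..
qed

end

theory Submission
  imports Defs "HOL-Real_Asymp.Real_Asymp"
begin

text \<open>
  Let \<open>v\<close> and the maximum colour class \<open>I\<close> witness the property, let \<open>W\<close> be the component of \<open>v\<close> in \<open>F\<close>,
  and put \<open>R = W - I - {v}\<close>. With high probability every vertex set \<open>U\<close> of the random graph with
  \<open>card U \<ge> sqrt n\<close> contains a clique \<open>K\<close> of size \<open>card R\<close> and a set \<open>L\<close> of common neighbours of \<open>K\<close> making
  up a constant fraction of \<open>U\<close>. Peel off such blocks \<open>(K, L)\<close> greedily until fewer than \<open>sqrt n\<close> vertices
  remain. The base graph consists of a copy of \<open>F - W\<close> and, for every block, a copy of \<open>F[R]\<close> on \<open>K\<close>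
  together with all edges between \<open>K\<close> and \<open>L\<close>. It is \<open>F\<close>-free by maximality of \<open>I\<close>. In every \<open>F\<close>-free
  graph \<open>H\<close> containing it, a vertex outside \<open>K\<close> and outside the copy of \<open>F - W\<close> has fewer than \<open>card (verts F)\<close>
  neighbours in \<open>L\<close>, as otherwise it could play the role of \<open>v\<close>. So peeling \<open>(K, L)\<close> off the current set \<open>U\<close>
  destroys only \<open>O(card U)\<close> edges of \<open>H\<close>, and as \<open>card U\<close> decreases geometrically, every \<open>F\<close>-saturated
  \<open>H\<close> containing the base graph has \<open>O(n)\<close> edges.
\<close>

section \<open>Cliques with many common neighbours, and peeling them off\<close>

text \<open>The only property of the random graph that the deterministic argument relies on; it is
  used with \<open>c = p / 8\<close> and \<open>m\<close> a constant multiple of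
  \<open>sqrt n\<close>.\<close>

definition rich :: "'a ugraph \<Rightarrow> real \<Rightarrow> real \<Rightarrow> bool" where
  "rich G c m \<longleftrightarrow> (\<forall>U. U \<subseteq> verts G \<longrightarrow> m \<le> real (card U) \<longrightarrow>
     (\<exists>x\<in>U. c * real (card U) \<le> real (card (nbhd G x \<inter> U))))"

definition block :: "'a ugraph \<Rightarrow> nat \<Rightarrow> 'a set \<Rightarrow> 'a set \<Rightarrow> bool" where
  "block G s K L \<longleftrightarrow> K \<inter> L = {} \<and> finite K \<and> card K = s \<and>
     (\<forall>x\<in>K. \<forall>y\<in>K \<union> L. x \<noteq> y \<longrightarrow> {x, y} \<in> edges G)"

text \<open>The clique grows one vertex at a time: a vertex with many neighbours in \<open>U\<close>
  is chosen and the search continues inside these neighbours, so each clique vertex costs a factor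
  \<open>c\<close>.\<close>

lemma rich_block_exists:
  assumes G: "simple_graph G" and rich: "rich G c m" and c: "0 < c" "c \<le> 1"
    and "U \<subseteq> verts G" and "m \<le> c ^ s * real (card U)"
  shows "\<exists>K L. block G s K L \<and> K \<subseteq> U \<and> L \<subseteq> U \<and> c ^ s * real (card U) \<le> real (card L)"
  using assms(5,6)
proof (induction s arbitrary: U)
  case 0
  then show ?case by (intro exI[of _ "{}"] exI[of _ U]) (auto simp: block_def)
next
  case (Suc s)
  have "c ^ Suc s * real (card U) \<le> 1 * real (card U)"
    using c by (intro mult_right_mono power_le_one) auto
  with Suc.prems have "m \<le> real (card U)" by linarith
  with Suc.prems(1) rich obtain x where x: "x \<in> U"
    and deg: "c * real (card U) \<le> real (card (nbhd G x \<inter> U))"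
    unfolding rich_def by blast
  let ?U = "nbhd G x \<inter> U"
  have ge: "c ^ Suc s * real (card U) \<le> c ^ s * real (card ?U)"
    using mult_left_mono[OF deg, of "c ^ s"] c by (simp add: mult_ac)
  have "?U \<subseteq> verts G" "m \<le> c ^ s * real (card ?U)" using Suc.prems ge by auto
  from Suc.IH[OF this] obtain K L where KO: "block G s K L" "K \<subseteq> ?U" "L \<subseteq> ?U"
    "c ^ s * real (card ?U) \<le> real (card L)" by blast
  have "{x} \<notin> edges G" using G by (auto simp: simple_graph_def)
  then have nx: "x \<notin> ?U" by (auto simp: nbhd_def)
  have nb: "{x, y} \<in> edges G" "{y, x} \<in> edges G" if "y \<in> K \<union> L" for y
    using that KO by (auto simp: nbhd_def insert_commute)
  have "x \<notin> K" "x \<notin> L" using nx KO by auto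
  with KO(1) nb have "block G (Suc s) (insert x K) L" by (auto simp: block_def)
  then show ?case using KO x ge by (intro exI[of _ "insert x K"] exI[of _ L]) auto
qed

text \<open>Peeling \<open>(K, L)\<close> loses at most \<open>D * card U\<close> edges meeting
  \<open>K\<close>, and at most \<open>D\<close> further edges into \<open>L\<close> per vertex of
  \<open>U - K\<close>. Since \<open>card U\<close> shrinks by the factor \<open>1 - q\<close>,
  these losses sum to \<open>2 * D / q * card U\<close>. The edge set \<open>E\<close> is quantified
  after \<open>Ps\<close> because the saturated graph is chosen only once the blocks are
  known.\<close>

lemma block_decomposition:
  fixes q M :: real and D :: nat
  assumes blocks: "\<And>U. U \<subseteq> V \<Longrightarrow> M \<le> real (card U) \<Longrightarrow>
      \<exists>K L. good K L \<and> finite K \<and> card K \<le> D \<and> K \<subseteq> U \<and> L \<subseteq> U \<and> q * real (card U) \<le> real (card L)"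
    and q: "0 < q" and M: "0 < M" and "finite U" "U \<subseteq> V"
  shows "\<exists>Ps. (\<forall>(K, L)\<in>Ps. good K L \<and> K \<union> L \<subseteq> U) \<and>
      (\<forall>P\<in>Ps. \<forall>Q\<in>Ps. P \<noteq> Q \<longrightarrow> (fst P \<union> snd P) \<inter> (fst Q \<union> snd Q) = {}) \<and>
      (\<forall>E. E \<subseteq> {e. card e = 2} \<longrightarrow>
         (\<forall>(K, L)\<in>Ps. \<forall>x\<in>U - K. card {y \<in> L. {x, y} \<in> E} \<le> D) \<longrightarrow>
         real (card (E \<inter> Pow U)) \<le> 2 * D / q * card U + M\<^sup>2)"
  using assms(4,5)
proof (induction "card U" arbitrary: U rule: less_induct)
  case (less U)
  note fin = less.prems(1)
  show ?case
  proof (cases "M \<le> real (card U)")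
    case False
    \<comment> \<open>Below the threshold peeling stops, and the trivial quadratic bound on the
      number of edges suffices.\<close>
    have "real (card (E \<inter> Pow U)) \<le> 2 * D / q * card U + M\<^sup>2" if E: "E \<subseteq> {e. card e = 2}" for E
    proof -
      have "E \<inter> Pow U \<subseteq> (\<lambda>(x, y). {x, y}) ` (U \<times> U)"
      proof
        fix e assume e: "e \<in> E \<inter> Pow U"
        then obtain x y where "e = {x, y}" using E by (auto simp: card_2_iff)
        with e show "e \<in> (\<lambda>(x, y). {x, y}) ` (U \<times> U)" by (intro image_eqI[of _ _ "(x, y)"]) auto
      qed
      then have "card (E \<inter> Pow U) \<le> card ((\<lambda>(x, y). {x, y}) ` (U \<times> U))"
        using fin by (intro card_mono) auto
      also have "\<dots> \<le> card U * card U"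
        using card_image_le[of "U \<times> U"] fin by (metis card_cartesian_product finite_cartesian_product)
      finally have "real (card (E \<inter> Pow U)) \<le> (real (card U))\<^sup>2"
        by (metis of_nat_le_iff of_nat_mult power2_eq_square)
      also have "\<dots> \<le> M\<^sup>2" using False by (intro power_mono) auto
      also have "\<dots> \<le> 2 * D / q * card U + M\<^sup>2" using q by simp
      finally show ?thesis .
    qed
    then show ?thesis by (intro exI[of _ "{}"]) auto
  next
    case True
    from blocks[OF less.prems(2) this] obtain K L where KO: "good K L" "finite K" "card K \<le> D"
      "K \<subseteq> U" "L \<subseteq> U" "q * real (card U) \<le> real (card L)" by blast
    let ?U = "U - K - L"
    have finO: "finite L" using fin KO by (auto intro: finite_subset)
    have "0 < q * real (card U)" using True M q by simp
    with KO(6) have "0 < card L" by linarith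
    then have "L \<noteq> {}" by auto
    with KO(5) have "?U \<subset> U" by auto
    then have lt: "card ?U < card U" using fin by (intro psubset_card_mono)
    have "card ?U \<le> card (U - L)" using fin by (intro card_mono) auto
    also have "\<dots> = card U - card L" using KO(5) finO by (simp add: card_Diff_subset)
    finally have "real (card ?U) \<le> real (card U) - real (card L)"
      using card_mono[OF fin KO(5)] by linarith
    with KO(6) have cU: "real (card ?U) \<le> (1 - q) * real (card U)" by (simp add: algebra_simps)
    have "finite ?U" "?U \<subseteq> V" using less.prems by auto
    from less.hyps[OF lt this] obtain Ps where
      Ps: "\<forall>(K, L)\<in>Ps. good K L \<and> K \<union> L \<subseteq> ?U"
        "\<forall>P\<in>Ps. \<forall>Q\<in>Ps. P \<noteq> Q \<longrightarrow> (fst P \<union> snd P) \<inter> (fst Q \<union> snd Q) = {}"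
      and cnt: "\<forall>E. E \<subseteq> {e. card e = 2} \<longrightarrow>
        (\<forall>(K, L)\<in>Ps. \<forall>x\<in>?U - K. card {y \<in> L. {x, y} \<in> E} \<le> D) \<longrightarrow>
         real (card (E \<inter> Pow ?U)) \<le> 2 * D / q * card ?U + M\<^sup>2" by (elim exE conjE)
    have count: "real (card (E \<inter> Pow U)) \<le> 2 * D / q * card U + M\<^sup>2"
      if E: "E \<subseteq> {e. card e = 2}"
        and deg: "\<forall>(K, L)\<in>insert (K, L) Ps. \<forall>x\<in>U - K. card {y \<in> L. {x, y} \<in> E} \<le> D" for E
    proof -
      \<comment> \<open>\<open>?A\<close> covers the edges meeting \<open>K\<close>.
        \<open>?B\<close> covers those avoiding \<open>K\<close> but meeting \<open>L\<close>, each
        charged to the endpoint opposite to one in \<open>L\<close>; edges inside \<open>L\<close>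
        are included.\<close>
      let ?A = "(\<lambda>(x, y). {x, y}) ` (K \<times> U)"
      let ?S = "SIGMA x:U - K. {y \<in> L. {x, y} \<in> E}"
      let ?B = "(\<lambda>(x, y). {x, y}) ` ?S"
      have finS: "finite ?S" using fin finO by auto
      have sub: "E \<inter> Pow U \<subseteq> (E \<inter> Pow ?U) \<union> ?A \<union> ?B"
      proof
        fix e assume e: "e \<in> E \<inter> Pow U"
        then obtain x y where xy: "e = {x, y}" using E by (auto simp: card_2_iff)
        have e': "{y, x} = e" "{x, y} = e" using xy by auto
        have xU: "x \<in> U" "y \<in> U" "e \<in> E" using e xy by auto
        consider "x \<in> K" | "y \<in> K" | "x \<notin> K" "y \<notin> K" "x \<in> L" | "x \<notin> K" "y \<notin> K" "y \<in> L"
          | "x \<in> ?U" "y \<in> ?U" using xU by blast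
        then show "e \<in> (E \<inter> Pow ?U) \<union> ?A \<union> ?B"
        proof cases
          case 1 then have "e \<in> ?A" using xU e' by (auto intro!: image_eqI[of _ _ "(x, y)"])
          then show ?thesis by blast
        next
          case 2 then have "e \<in> ?A" using xU e' by (auto intro!: image_eqI[of _ _ "(y, x)"])
          then show ?thesis by blast
        next
          case 3 then have "e \<in> ?B" using xU e' by (auto intro!: image_eqI[of _ _ "(y, x)"])
          then show ?thesis by blast
        next
          case 4 then have "e \<in> ?B" using xU e' by (auto intro!: image_eqI[of _ _ "(x, y)"])
          then show ?thesis by blast
        next
          case 5 then show ?thesis using xU xy by auto
        qed
      qed
      have "card ?A \<le> card (K \<times> U)" using fin KO(2) by (intro card_image_le) auto
      also have "\<dots> \<le> D * card U" using KO(3) by (simp add: card_cartesian_product)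
      finally have cA: "card ?A \<le> D * card U" .
      have "card ?B \<le> card ?S" using finS by (rule card_image_le)
      also have "\<dots> = (\<Sum>x\<in>U - K. card {y \<in> L. {x, y} \<in> E})"
        using fin finO by (intro card_SigmaI) auto
      also have "\<dots> \<le> (\<Sum>x\<in>U - K. D)" using deg by (intro sum_mono) auto
      also have "\<dots> \<le> D * card U" using fin by (simp add: card_mono)
      finally have cB: "card ?B \<le> D * card U" .
      have "card (E \<inter> Pow U) \<le> card ((E \<inter> Pow ?U) \<union> ?A \<union> ?B)"
        using sub fin KO(2) finS by (intro card_mono) auto
      also have "\<dots> \<le> card (E \<inter> Pow ?U) + card ?A + card ?B"
        by (meson add_right_mono card_Un_le order_trans)
      finally have "real (card (E \<inter> Pow U)) \<le> real (card (E \<inter> Pow ?U)) + 2 * (real D * real (card U))"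
        using cA cB by (simp flip: of_nat_mult of_nat_add)
      also have "real (card (E \<inter> Pow ?U)) \<le> 2 * D / q * card ?U + M\<^sup>2"
        using E deg by (intro cnt[rule_format]) auto
      also have "2 * D / q * card ?U \<le> 2 * D / q * ((1 - q) * real (card U))"
        using cU q by (intro mult_left_mono) auto
      \<comment> \<open>The loss \<open>2 * D * card U\<close> is exactly \<open>2 * D / q\<close>
        times the guaranteed decrease \<open>q * card U\<close>.\<close>
      also have "2 * D / q * ((1 - q) * real (card U)) + M\<^sup>2 + 2 * (real D * real (card U))
          = 2 * D / q * card U + M\<^sup>2"
        using q by (simp add: field_simps)
      finally show ?thesis by simp
    qed
    have disj: "\<forall>P\<in>insert (K, L) Ps. \<forall>Q\<in>insert (K, L) Ps.
        P \<noteq> Q \<longrightarrow> (fst P \<union> snd P) \<inter> (fst Q \<union> snd Q) = {}"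
    proof -
      have "(fst P \<union> snd P) \<inter> (K \<union> L) = {}" if "P \<in> Ps" for P using Ps(1) that by (cases P) auto
      then show ?thesis using Ps(2) by (auto simp: Int_commute)
    qed
    have "\<forall>(K, L)\<in>insert (K, L) Ps. good K L \<and> K \<union> L \<subseteq> U" using Ps(1) KO by auto
    then show ?thesis
      by (intro exI[of _ "insert (K, L) Ps"] conjI disj allI impI count) assumption+
  qed
qed

section \<open>The component of \<open>v\<close> and the maximum colour class\<close>

text \<open>Maximality is stated for the single colour \<open>i\<^sub>0\<close>; as colours can be
  permuted, this is the same as comparing with all classes.\<close>

locale maximum_class =
  fixes F :: "'a ugraph" and k :: nat and c :: "'a \<Rightarrow> nat" and i\<^sub>0 :: nat and v :: 'a
  assumes simple: "simple_graph F" and no_iso: "no_isolated_vertices F"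
    and col: "proper_colouring F k c" and i0: "i\<^sub>0 < k"
    and max: "\<And>c'. proper_colouring F k c' \<Longrightarrow>
      card {w \<in> verts F. c' w = i\<^sub>0} \<le> card {w \<in> verts F. c w = i\<^sub>0}"
    and v: "v \<in> verts F" "c v \<noteq> i\<^sub>0" and nbhd_v: "nbhd F v \<subseteq> {w \<in> verts F. c w = i\<^sub>0}"
begin

definition reach :: "('a \<times> 'a) set" where
  "reach = {(x, y). {x, y} \<in> edges F}\<^sup>*"

definition W :: "'a set" where "W = {w. (v, w) \<in> reach}"

definition I :: "'a set" where "I = {w \<in> verts F. c w = i\<^sub>0}"

definition R :: "'a set" where "R = W - I - {v}"

lemma finite_verts: "finite (verts F)"
  using simple by (simp add: simple_graph_def)

lemma edge_verts: "{x, y} \<in> edges F \<Longrightarrow> x \<in> verts F \<and> y \<in> verts F"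
  using simple by (auto simp: simple_graph_def)

lemma edgeE:
  assumes "e \<in> edges F"
  obtains x y where "e = {x, y}" "{x, y} \<in> edges F"
proof -
  have "card e = 2" using assms simple by (auto simp: simple_graph_def)
  then obtain x y where "e = {x, y}" by (auto simp: card_2_iff)
  with assms that show ?thesis by blast
qed

lemma reach_invariant:
  assumes "(x, y) \<in> reach" and "\<And>a b. {a, b} \<in> edges F \<Longrightarrow> l a = l b"
  shows "l x = l y"
  using assms(1) unfolding reach_def
  by (induction rule: rtrancl_induct) (use assms(2) in auto)

lemma reach_verts: "(x, y) \<in> reach \<Longrightarrow> x \<in> verts F \<Longrightarrow> y \<in> verts F"
  unfolding reach_def by (induction rule: rtrancl_induct) (use edge_verts in auto)

lemma W_verts: "W \<subseteq> verts F"
  using reach_verts v by (auto simp: W_def)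

lemma v_in_W: "v \<in> W" by (simp add: W_def reach_def)

lemma R_verts: "R \<subseteq> verts F" using W_verts by (auto simp: R_def)

lemma W_edge: "{x, y} \<in> edges F \<Longrightarrow> x \<in> W \<longleftrightarrow> y \<in> W"
  unfolding W_def reach_def
  by (auto simp: insert_commute intro: rtrancl_into_rtrancl)

text \<open>This is what allows a vertex with many neighbours in some \<open>L\<close>, but possibly
  none in \<open>K\<close>, to play the role of \<open>v\<close>.\<close>

lemma nbhd_v_W: "{v, w} \<in> edges F \<Longrightarrow> w \<in> W \<inter> I"
  using W_edge v_in_W nbhd_v by (auto simp: nbhd_def I_def)

text \<open>Removing \<open>v\<close> makes \<open>R\<close> one smaller than \<open>W - I\<close>;
  this surplus of one contradicts maximality later. The additive form avoids subtraction on
  naturals.\<close>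

lemma card_R: "card R + 1 + card I = card W + card (I - W)"
proof -
  have fin: "finite W" "finite I"
    using finite_verts W_verts by (auto simp: I_def intro: finite_subset)
  have "v \<in> W - I" using v_in_W v by (auto simp: I_def)
  then have "card R + 1 = card (W - I)" using fin card_Suc_Diff1[of "W - I" v] by (simp add: R_def)
  moreover have "card (W - I) + card (W \<inter> I) = card W"
    using fin card_Int_Diff[of W I] by simp
  moreover have "card (I - W) + card (W \<inter> I) = card I"
    using fin card_Int_Diff[of I W] by (simp add: Int_commute)
  ultimately show ?thesis by linarith
qed

end

section \<open>The base graph: it is \<open>F\<close>-free, and large degree into a block completes
  a copy\<close>

text \<open>\<open>g\<close> places \<open>F - W\<close>, and \<open>\<phi> P\<close> places
  \<open>R\<close> on the clique side of the block \<open>P\<close>. No host graph occurs: freeness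
  of the base graph depends only on these placements and their disjointness.\<close>

locale block_system = maximum_class F k c i\<^sub>0 v
  for F :: "'a ugraph" and k c i\<^sub>0 v +
  fixes g :: "'a \<Rightarrow> 'b" and Ps :: "('b set \<times> 'b set) set" and \<phi> :: "'b set \<times> 'b set \<Rightarrow> 'a \<Rightarrow> 'b"
  assumes g_inj: "inj_on g (verts F - W)"
    and \<phi>_bij: "P \<in> Ps \<Longrightarrow> bij_betw (\<phi> P) R (fst P)"
    and P_disj: "P \<in> Ps \<Longrightarrow> fst P \<inter> snd P = {}"
    and Ps_disj: "P \<in> Ps \<Longrightarrow> Q \<in> Ps \<Longrightarrow> P \<noteq> Q \<Longrightarrow> (fst P \<union> snd P) \<inter> (fst Q \<union> snd Q) = {}"
    and g_disj: "P \<in> Ps \<Longrightarrow> (fst P \<union> snd P) \<inter> g ` (verts F - W) = {}"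
begin

definition block_edges :: "'b set \<times> 'b set \<Rightarrow> 'b set set" where
  "block_edges P = (`) (\<phi> P) ` {e \<in> edges F. e \<subseteq> R} \<union> {{x, y} | x y. x \<in> fst P \<and> y \<in> snd P}"

definition base_edges :: "'b set set" where
  "base_edges = (`) g ` {e \<in> edges F. e \<inter> W = {}} \<union> (\<Union>P\<in>Ps. block_edges P)"

lemma base_edgesE:
  assumes "{x, y} \<in> base_edges"
  obtains (outside) a b where "{a, b} \<in> edges F" "a \<in> verts F - W" "b \<in> verts F - W" "x = g a" "y = g b"
  | (inner) P a b where "P \<in> Ps" "{a, b} \<in> edges F" "a \<in> R" "b \<in> R" "x = \<phi> P a" "y = \<phi> P b"
  | (left) P where "P \<in> Ps" "x \<in> fst P" "y \<in> snd P"
  | (right) P where "P \<in> Ps" "x \<in> snd P" "y \<in> fst P"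
proof -
  from assms consider (1) e where "e \<in> edges F" "e \<inter> W = {}" "{x, y} = g ` e"
    | (2) P e where "P \<in> Ps" "e \<in> edges F" "e \<subseteq> R" "{x, y} = \<phi> P ` e"
    | (3) P x' y' where "P \<in> Ps" "{x, y} = {x', y'}" "x' \<in> fst P" "y' \<in> snd P"
    unfolding base_edges_def block_edges_def
    by (elim UnE UN_E imageE CollectE exE conjE) metis+
  then show ?thesis
  proof cases
    case 1
    from \<open>e \<in> edges F\<close> obtain a b where ab: "e = {a, b}" "{a, b} \<in> edges F" by (rule edgeE)
    with 1 have d: "(x = g a \<and> y = g b) \<or> (x = g b \<and> y = g a)" by (simp add: doubleton_eq_iff)
    have "{b, a} \<in> edges F" "a \<in> verts F - W" "b \<in> verts F - W"
      using ab 1 edge_verts[of a b] by (auto simp: insert_commute)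
    then show ?thesis using d ab outside[of a b] outside[of b a] by blast
  next
    case 2
    from \<open>e \<in> edges F\<close> obtain a b where ab: "e = {a, b}" "{a, b} \<in> edges F" by (rule edgeE)
    with 2 have d: "(x = \<phi> P a \<and> y = \<phi> P b) \<or> (x = \<phi> P b \<and> y = \<phi> P a)" by (simp add: doubleton_eq_iff)
    have "{b, a} \<in> edges F" "a \<in> R" "b \<in> R"
      using ab 2 by (auto simp: insert_commute)
    then show ?thesis using d ab 2(1) inner[of P a b] inner[of P b a] by blast
  next
    case 3
    then have "(x = x' \<and> y = y') \<or> (x = y' \<and> y = x')" by (simp add: doubleton_eq_iff)
    then show ?thesis using 3 left[of P] right[of P] by blast
  qed
qed

lemma \<phi>_fst: "P \<in> Ps \<Longrightarrow> a \<in> R \<Longrightarrow> \<phi> P a \<in> fst P"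
  using \<phi>_bij bij_betwE by blast

text \<open>The block containing \<open>x\<close>, encoded as a singleton, or the empty set if there
  is none. Being constant along base edges, it is constant on the image of every component of
  \<open>F\<close>.\<close>

definition label :: "'b \<Rightarrow> ('b set \<times> 'b set) set" where
  "label x = {P \<in> Ps. x \<in> fst P \<union> snd P}"

lemma label_block: "P \<in> Ps \<Longrightarrow> x \<in> fst P \<union> snd P \<Longrightarrow> label x = {P}"
  using Ps_disj unfolding label_def by blast

lemma label_outside: "a \<in> verts F - W \<Longrightarrow> label (g a) = {}"
  using g_disj unfolding label_def by blast

lemma label_edge: "{x, y} \<in> base_edges \<Longrightarrow> label x = label y"
  by (erule base_edgesE) (use label_block label_outside \<phi>_fst in auto)

lemma label_cases:
  assumes "{x, y} \<in> base_edges"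
  shows "(label x = {} \<and> x \<in> g ` (verts F - W)) \<or> (\<exists>P\<in>Ps. label x = {P})"
  using assms by (rule base_edgesE) (use label_block label_outside \<phi>_fst in auto)

text \<open>Recolouring the component \<open>W\<close> along its embedding into a block, with the vertices of \<open>snd P\<close>
  coloured \<open>i\<^sub>0\<close>, would enlarge the maximum class, because \<open>fst P\<close> has only \<open>card (W - I) - 1\<close> vertices.\<close>

lemma component_not_in_block:
  assumes P: "P \<in> Ps" and h_inj: "inj_on h W" and h_lab: "\<And>w. w \<in> W \<Longrightarrow> label (h w) = {P}"
    and h_edge: "\<And>a b. a \<in> W \<Longrightarrow> b \<in> W \<Longrightarrow> {a, b} \<in> edges F \<Longrightarrow> {h a, h b} \<in> base_edges"
  shows False
proof -
  let ?\<psi> = "inv_into R (\<phi> P)"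
  have inj: "inj_on (\<phi> P) R" and img: "\<phi> P ` R = fst P"
    using \<phi>_bij[OF P] by (auto simp: bij_betw_def)
  \<comment> \<open>On \<open>fst P\<close> colours are pulled back from \<open>R\<close>, where
    \<open>i\<^sub>0\<close> does not occur, so edges between \<open>fst P\<close> and
    \<open>snd P\<close> are properly coloured.\<close>
  define c' where "c' w = (if w \<in> W then if h w \<in> snd P then i\<^sub>0 else c (?\<psi> (h w)) else c w)" for w
  have in_P: "h w \<in> fst P \<or> h w \<in> snd P" if "w \<in> W" for w
    using h_lab[OF that] unfolding label_def by blast
  have \<psi>R: "?\<psi> x \<in> R" if "x \<in> fst P" for x using that img by (metis inv_into_into)
  have cR: "c a \<noteq> i\<^sub>0" "c a < k" if "a \<in> R" for a
    using that col W_verts by (auto simp: R_def I_def proper_colouring_def)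
  have "proper_colouring F k c'"
    unfolding proper_colouring_def
  proof (intro conjI allI impI)
    show "c' ` verts F \<subseteq> {..<k}"
    proof
      fix i assume "i \<in> c' ` verts F"
      then obtain w where w: "w \<in> verts F" "i = c' w" by auto
      have "c w < k" using col w by (auto simp: proper_colouring_def)
      moreover have "c (?\<psi> (h w)) < k" if "w \<in> W" "h w \<notin> snd P" using cR(2)[OF \<psi>R] in_P that by blast
      ultimately show "i \<in> {..<k}" using w i0 by (simp add: c'_def)
    qed
  next
    fix a b assume ab: "{a, b} \<in> edges F"
    show "c' a \<noteq> c' b"
    proof (cases "a \<in> W")
      case False
      then have "b \<notin> W" using W_edge[OF ab] by simp
      with False ab col show ?thesis by (simp add: c'_def proper_colouring_def)
    next
      case True
      then have bW: "b \<in> W" using W_edge[OF ab] by simp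
      note la = h_lab[OF True] and lb = h_lab[OF bW]
      have fs: "x \<notin> snd P" if "x \<in> fst P" for x using P_disj[OF P] that by blast
      from h_edge[OF True bW ab] show ?thesis
      proof (cases rule: base_edgesE)
        case (outside a' b')
        then show ?thesis using la label_outside by auto
      next
        case (inner Q a' b')
        then have "Q = P" using la label_block[of Q "h a"] \<phi>_fst by auto
        with inner fs have "c' a = c a'" "c' b = c b'"
          using inj True bW \<phi>_fst[OF P] by (auto simp: c'_def)
        then show ?thesis using inner(2) col by (simp add: proper_colouring_def)
      next
        case (left Q)
        then have "Q = P" using la label_block[of Q "h a"] by auto
        with left fs have "h a \<in> fst P" "h b \<in> snd P" "h a \<notin> snd P" by auto
        then show ?thesis using True bW cR(1)[OF \<psi>R, of "h a"] by (simp add: c'_def)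
      next
        case (right Q)
        then have "Q = P" using la label_block[of Q "h a"] by auto
        with right fs have "h b \<in> fst P" "h a \<in> snd P" "h b \<notin> snd P" by auto
        then show ?thesis using True bW cR(1)[OF \<psi>R, of "h b"] by (simp add: c'_def)
      qed
    qed
  qed
  from max[OF this] have le: "card {w \<in> verts F. c' w = i\<^sub>0} \<le> card I" by (simp add: I_def)
  let ?A = "{w \<in> W. h w \<in> snd P}" and ?B = "{w \<in> W. h w \<in> fst P}"
  have finW: "finite W" using W_verts finite_verts finite_subset by blast
  have finI: "finite I" using finite_verts by (simp add: I_def)
  have finR: "finite R" using finW by (simp add: R_def)
  have "card ?B = card (h ` ?B)" using h_inj by (metis (no_types, lifting) card_image inj_on_subset mem_Collect_eq subsetI)
  also have "\<dots> \<le> card (fst P)" using finite_imageI[OF finR, of "\<phi> P"] img by (intro card_mono) auto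
  also have "\<dots> = card R" using \<phi>_bij[OF P] bij_betw_same_card by metis
  finally have B: "card ?B \<le> card R" .
  have "W \<subseteq> ?A \<union> ?B" using in_P by auto
  then have "card W \<le> card ?A + card ?B"
    using finW card_mono[of "?A \<union> ?B" W] card_Un_le[of ?A ?B] by auto
  \<comment> \<open>At most \<open>card R\<close> vertices of \<open>W\<close> lie over
    \<open>fst P\<close>, so by \<open>card_R\<close> the new class
    \<open>?A \<union> (I - W)\<close> has at least \<open>card I + 1\<close> elements.\<close>
  moreover have "card ?A + card (I - W) = card (?A \<union> (I - W))"
    using finW finI by (subst card_Un_disjoint) auto
  moreover have "card (?A \<union> (I - W)) \<le> card {w \<in> verts F. c' w = i\<^sub>0}"
    using finite_verts W_verts by (intro card_mono) (auto simp: c'_def I_def)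
  ultimately show False using B le card_R by linarith
qed

text \<open>Let \<open>B\<close> be the union of the components of \<open>F\<close> into which \<open>W\<close> embeds. A copy of \<open>F\<close> would have
  to place all of \<open>B\<close> on the copy of \<open>F - W\<close>, and hence inject \<open>B\<close> into \<open>B - W\<close>.\<close>

lemma base_free: "\<not> contains_copy (UGraph V base_edges) F"
proof
  assume "contains_copy (UGraph V base_edges) F"
  then obtain f where f_inj: "inj_on f (verts F)" and f_edge: "\<And>e. e \<in> edges F \<Longrightarrow> f ` e \<in> base_edges"
    unfolding contains_copy_def by auto
  have f_edge': "{f a, f b} \<in> base_edges" if "{a, b} \<in> edges F" for a b using f_edge[OF that] by simp
  have lab_reach: "label (f a) = label (f b)" if "(a, b) \<in> reach" for a b
    using that by (rule reach_invariant) (use f_edge' label_edge in blast)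
  define emb where "emb h \<longleftrightarrow> inj_on h W \<and> h ` W \<subseteq> verts F \<and>
    (\<forall>a b. a \<in> W \<longrightarrow> b \<in> W \<longrightarrow> {a, b} \<in> edges F \<longrightarrow> {h a, h b} \<in> edges F)" for h :: "'a \<Rightarrow> 'a"
  define B where "B = {y. \<exists>h. emb h \<and> (h v, y) \<in> reach}"
  define \<psi> where "\<psi> y = inv_into (verts F - W) g (f y)" for y
  have nb: "\<exists>b. {a, b} \<in> edges F" if "a \<in> verts F" for a
    using that no_iso by (auto simp: no_isolated_vertices_def nbhd_def)
  \<comment> \<open>\<open>f \<circ> h\<close> sends each edge of a path from \<open>v\<close>
    inside \<open>W\<close> to a base edge, which preserves the label.\<close>
  have lab_emb: "label (f (h w)) = label (f (h v))" if "emb h" "w \<in> W" for h w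
  proof -
    have "(v, w) \<in> reach" using that by (simp add: W_def)
    then have "w \<in> W \<and> label (f (h w)) = label (f (h v))"
      unfolding reach_def
    proof (induction rule: rtrancl_induct)
      case base then show ?case using v_in_W by simp
    next
      case (step y z)
      then have "z \<in> W" using W_edge by auto
      moreover have "{h y, h z} \<in> edges F" using step \<open>z \<in> W\<close> that(1) by (auto simp: emb_def)
      ultimately show ?case using step label_edge[OF f_edge'] by auto
    qed
    then show ?thesis ..
  qed
  have emb_outside: "label (f (h v)) = {}" if h: "emb h" for h
  proof (rule ccontr)
    assume ne: "label (f (h v)) \<noteq> {}"
    have "h v \<in> verts F" using h v_in_W by (auto simp: emb_def)
    then obtain b where "{h v, b} \<in> edges F" using nb by blast
    with ne obtain P where P: "P \<in> Ps" "label (f (h v)) = {P}" using label_cases[OF f_edge'] by blast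
    show False
    proof (rule component_not_in_block[OF P(1), of "f \<circ> h"])
      show "inj_on (f \<circ> h) W"
        using h f_inj by (auto simp: emb_def intro!: comp_inj_on intro: inj_on_subset)
    qed (use h P lab_emb f_edge' in \<open>auto simp: emb_def\<close>)
  qed
  have B_verts: "B \<subseteq> verts F"
    using reach_verts v_in_W unfolding B_def emb_def by blast
  \<comment> \<open>An empty label would also fit a vertex of \<open>V\<close> outside all blocks
    and outside the copy of \<open>F - W\<close>; the edge at \<open>y\<close> rules this out, as no
    base edge meets such a vertex.\<close>
  have outside: "f y \<in> g ` (verts F - W)" if y: "y \<in> verts F" "label (f y) = {}" for y
    using nb[OF y(1)] label_cases[OF f_edge'] y(2) by blast
  have g\<psi>: "g (\<psi> y) = f y" "\<psi> y \<in> verts F - W" if "y \<in> verts F" "label (f y) = {}" for y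
    using outside[OF that] unfolding \<psi>_def by (rule f_inv_into_f, rule inv_into_into)
  have \<psi>_edge: "{\<psi> a, \<psi> b} \<in> edges F" if ab: "{a, b} \<in> edges F" and la: "label (f a) = {}" for a b
  proof -
    from f_edge'[OF ab] show ?thesis
    proof (cases rule: base_edgesE)
      case (outside a' b')
      then have "\<psi> a = a'" "\<psi> b = b'" using g_inj by (auto simp: \<psi>_def)
      with outside show ?thesis by simp
    next
      case (inner P a' b') then show ?thesis using la label_block[of P] \<phi>_fst by auto
    next
      case (left P) then show ?thesis using la label_block[of P] by auto
    next
      case (right P) then show ?thesis using la label_block[of P] by auto
    qed
  qed
  have B_lab: "label (f y) = {}" if "y \<in> B" for y
    using that emb_outside lab_reach unfolding B_def by force
  have \<psi>_inj: "inj_on \<psi> B"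
    by (rule inj_onI) (metis B_lab B_verts f_inj g\<psi>(1) inj_onD subsetD)
  \<comment> \<open>On vertices with empty label \<open>\<psi>\<close> preserves edges. So
    \<open>\<psi> \<circ> h\<close> is again an embedding of \<open>W\<close>, and the path from
    \<open>h v\<close> to \<open>y\<close> is carried to one from \<open>\<psi> (h v)\<close> to
    \<open>\<psi> y\<close>.\<close>
  have "\<psi> y \<in> B" if "y \<in> B" for y
  proof -
    from that obtain h where h: "emb h" "(h v, y) \<in> reach" by (auto simp: B_def)
    have hl: "label (f (h w)) = {}" if "w \<in> W" for w using lab_emb[OF h(1) that] emb_outside[OF h(1)] by simp
    have hW: "h w \<in> verts F" if "w \<in> W" for w using that h by (auto simp: emb_def)
    have hB: "h w \<in> verts F" "f (h w) = g (\<psi> (h w))" "\<psi> (h w) \<in> verts F" if "w \<in> W" for w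
      using g\<psi> hl hW that by auto
    have inj: "inj_on (\<psi> \<circ> h) W"
    proof (rule inj_onI)
      fix a b assume ab: "a \<in> W" "b \<in> W" "(\<psi> \<circ> h) a = (\<psi> \<circ> h) b"
      then have "f (h a) = f (h b)" using hB by simp
      then have "h a = h b" using f_inj hB ab by (meson inj_onD)
      then show "a = b" using ab h by (auto simp: emb_def dest: inj_onD)
    qed
    have "emb (\<psi> \<circ> h)" unfolding emb_def
      using inj h hB hl \<psi>_edge by (auto simp: emb_def)
    moreover have "(\<psi> (h v), \<psi> y) \<in> reach"
    proof -
      from h(2) have "label (f y) = {} \<and> (\<psi> (h v), \<psi> y) \<in> reach"
        unfolding reach_def
      proof (induction rule: rtrancl_induct)
        case base then show ?case using emb_outside[OF h(1)] by simp
      next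
        case (step y z)
        then have yz: "{y, z} \<in> edges F" "label (f y) = {}" by auto
        then have "label (f z) = {}" using label_edge[OF f_edge'] by auto
        then show ?case using step \<psi>_edge[OF yz] by (auto intro: rtrancl_into_rtrancl)
      qed
      then show ?thesis ..
    qed
    ultimately show ?thesis unfolding B_def by (auto intro!: exI[of _ "\<psi> \<circ> h"])
  qed
  moreover have "\<psi> y \<notin> W" if "y \<in> B" for y using g\<psi>(2)[of y] B_lab[OF that] B_verts that by auto
  ultimately have sub: "\<psi> ` B \<subseteq> B - W" by auto
  have "emb id" using W_verts by (simp add: emb_def)
  then have "v \<in> B" unfolding B_def reach_def by (auto intro!: exI[of _ id])
  then have "B - W \<subset> B" using v_in_W by blast
  moreover have "finite B" using B_verts finite_verts finite_subset by blast
  ultimately have "card (B - W) < card B" by (simp add: psubset_card_mono)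
  moreover have "card B \<le> card (B - W)"
    using card_mono[OF _ sub] card_image[OF \<psi>_inj] \<open>finite B\<close> by simp
  ultimately show False by simp
qed

text \<open>\<open>x\<close> plays \<open>v\<close>, neighbours of \<open>x\<close> in
  \<open>snd P\<close> play \<open>W \<inter> I\<close>, \<open>fst P\<close> carries
  \<open>R\<close>, and \<open>g\<close> carries \<open>F - W\<close>. Edges at \<open>v\<close>
  lead into \<open>W \<inter> I\<close>; all other edges of \<open>F\<close> are mapped to base
  edges.\<close>

lemma large_degree_creates_copy:
  assumes H: "base_edges \<subseteq> edges H" "simple_graph H" "g ` (verts F - W) \<subseteq> verts H"
    and P: "P \<in> Ps" "fst P \<subseteq> verts H" and x: "x \<notin> fst P" "x \<notin> g ` (verts F - W)" "x \<in> verts H"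
    and deg: "card (verts F) \<le> card {y \<in> snd P. {x, y} \<in> edges H}"
  shows "contains_copy H F"
proof -
  let ?N = "{y \<in> snd P. {x, y} \<in> edges H}"
  have sizes: "card e = 2" "e \<subseteq> verts H" if "e \<in> edges H" for e using that H(2) by (auto simp: simple_graph_def)
  have NH: "?N \<subseteq> verts H" using sizes by blast
  have finN: "finite ?N" using NH H(2) finite_subset by (auto simp: simple_graph_def)
  have xN: "x \<notin> ?N" using sizes(1)[of "{x}"] by auto
  have WI: "W \<inter> I \<subseteq> verts F" using W_verts by auto
  then have "card (W \<inter> I) \<le> card ?N" using deg card_mono[OF finite_verts WI] by simp
  then obtain j where j: "j ` (W \<inter> I) \<subseteq> ?N" "inj_on j (W \<inter> I)"
    using card_le_inj[of "W \<inter> I" ?N] finite_subset[OF WI finite_verts] finN by blast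
  have \<phi>: "inj_on (\<phi> P) R" "\<phi> P ` R = fst P" using \<phi>_bij[OF P(1)] by (auto simp: bij_betw_def)
  define f where "f w = (if w = v then x else if w \<in> W \<inter> I then j w else if w \<in> W then \<phi> P w else g w)" for w
  have vI: "v \<notin> I" using v by (simp add: I_def)
  have fv: "f v = x" by (simp add: f_def)
  have fI: "f w = j w" "f w \<in> ?N" if "w \<in> W \<inter> I" for w using that j vI by (auto simp: f_def)
  have fR: "f w = \<phi> P w" "f w \<in> fst P" if "w \<in> R" for w
    using that \<phi> by (auto simp: f_def R_def)
  have fG: "f w = g w" "f w \<in> g ` (verts F - W)" if "w \<in> verts F - W" for w
    using that v_in_W by (auto simp: f_def)
  have split: "w = v \<or> w \<in> W \<inter> I \<or> w \<in> R \<or> w \<in> verts F - W" if "w \<in> verts F" for w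
    using that by (auto simp: R_def)
  have d: "fst P \<inter> snd P = {}" "fst P \<inter> g ` (verts F - W) = {}" "snd P \<inter> g ` (verts F - W) = {}"
    using P_disj[OF P(1)] g_disj[OF P(1)] by auto
  have "inj_on f (verts F)"
  proof (rule inj_onI)
    fix a b assume ab: "a \<in> verts F" "b \<in> verts F" "f a = f b"
    have key: "a = b" if "a = v" "f a = f b" "b \<in> verts F" for a b
      using split[OF that(3)] that(1,2) fv fI(2)[of b] fR(2)[of b] fG(2)[of b] xN x by auto
    show "a = b"
    proof (cases "a = v \<or> b = v")
      case True then show ?thesis using key[of a b] key[of b a] ab by auto
    next
      case False
      then consider "a \<in> W \<inter> I" "b \<in> W \<inter> I" | "a \<in> R" "b \<in> R" | "a \<in> verts F - W" "b \<in> verts F - W"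
        using split[OF ab(1)] split[OF ab(2)] fI(2)[of a] fI(2)[of b] fR(2)[of a] fR(2)[of b]
          fG(2)[of a] fG(2)[of b] ab(3) d by (smt (verit) disjoint_iff mem_Collect_eq)
      then show ?thesis
        using ab(3) fI(1) fR(1) fG(1) j(2) \<phi>(1) g_inj by cases (auto dest: inj_onD)
    qed
  qed
  moreover have "f w \<in> verts H" if "w \<in> verts F" for w
    using split[OF that] fv fI(2)[of w] fR(2)[of w] fG(2)[of w] NH H(3) P(2) x(3) by auto
  moreover have "f ` e \<in> edges H" if e: "e \<in> edges F" for e
  proof -
    obtain a b where ab: "e = {a, b}" "{a, b} \<in> edges F" using e by (rule edgeE)
    have ba: "{b, a} \<in> edges F" using ab by (simp add: insert_commute)
    have swap: "{f b, f a} \<in> edges H \<Longrightarrow> {f a, f b} \<in> edges H" by (simp add: insert_commute)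
    have *: "{x, f w} \<in> edges H" if "{v, w} \<in> edges F" for w
      using fI(2)[OF nbhd_v_W[OF that]] by simp
    have cross: "{f w, f u} \<in> edges H" if "w \<in> R" "u \<in> W \<inter> I" for u w
    proof -
      have "{f w, f u} \<in> block_edges P" using fR(2)[OF that(1)] fI(2)[OF that(2)] by (auto simp: block_edges_def)
      then show ?thesis using H(1) P(1) by (auto simp: base_edges_def)
    qed
    \<comment> \<open>\<open>I\<close> is a colour class, so no edge has to be realised between two
      vertices placed in \<open>snd P\<close>.\<close>
    have nII: "\<not> (a \<in> I \<and> b \<in> I)" using ab(2) col unfolding I_def proper_colouring_def by force
    have "{f a, f b} \<in> edges H"
    proof (cases "a \<in> W")
      case False
      then have bW: "b \<notin> W" using W_edge[OF ab(2)] by simp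
      have "f a = g a" "f b = g b" using fG(1) False bW edge_verts[OF ab(2)] by auto
      moreover have "g ` {a, b} \<in> base_edges"
        unfolding base_edges_def by (intro UnI1 imageI) (use False bW ab(2) in auto)
      ultimately show ?thesis using H(1) by auto
    next
      case True
      then have bW: "b \<in> W" using W_edge[OF ab(2)] by simp
      consider "a = v" | "b = v" | "a \<in> R" "b \<in> R" | "a \<in> R" "b \<in> W \<inter> I" | "b \<in> R" "a \<in> W \<inter> I"
        using True bW nII by (auto simp: R_def)
      then show ?thesis
      proof cases
        case 1 then show ?thesis using * ab(2) fv by auto
      next
        case 2 then show ?thesis using * ba fv by (intro swap) auto
      next
        case 3
        then have "\<phi> P ` {a, b} \<in> block_edges P" 
          unfolding block_edges_def by (intro UnI1 imageI) (use ab(2) in auto)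
        then show ?thesis using 3 H(1) P(1) fR(1) by (auto simp: base_edges_def)
      next
        case 4 then show ?thesis using cross by blast
      next
        case 5 then show ?thesis using cross swap by blast
      qed
    qed
    then show ?thesis using ab(1) by simp
  qed
  ultimately show ?thesis unfolding contains_copy_def by blast
qed

end

section \<open>Saturated graphs above the base graph, and the linear edge bound\<close>

text \<open>An inclusion-maximal \<open>F\<close>-free edge set above \<open>E\<^sub>0\<close> is
  saturated. Keeping all vertices of \<open>G\<close> ensures that adding an edge leaves the vertex
  set unchanged.\<close>

lemma saturated_extension_exists:
  assumes G: "simple_graph G" and E0: "E\<^sub>0 \<subseteq> edges G"
    and free: "\<not> contains_copy (UGraph (verts G) E\<^sub>0) F"
  shows "\<exists>E. E\<^sub>0 \<subseteq> E \<and> saturated_in (UGraph (verts G) E) G F"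
proof -
  let ?S = "{E. E \<subseteq> edges G \<and> \<not> contains_copy (UGraph (verts G) E) F}"
  have "edges G \<subseteq> Pow (verts G)" "finite (verts G)"
    using G by (auto simp: simple_graph_def)
  then have "finite (edges G)"
    by (meson finite_Pow_iff finite_subset)
  then have fin: "finite ?S" by simp
  have "E\<^sub>0 \<in> ?S" using E0 free by simp
  from finite_has_maximal2[OF fin this] obtain E
    where E: "E \<in> ?S" "E\<^sub>0 \<subseteq> E" and max: "\<forall>D\<in>?S. E \<subseteq> D \<longrightarrow> E = D" by blast
  have "contains_copy (add_edge (UGraph (verts G) E) e) F" if e: "e \<in> edges G - E" for e
  proof -
    have "verts G \<union> e = verts G" using e G by (auto simp: simple_graph_def)
    moreover have "insert e E \<notin> ?S" using max e by blast
    ultimately show ?thesis using e E by (auto simp: add_edge_def)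
  qed
  then have "saturated_in (UGraph (verts G) E) G F"
    using E G by (auto simp: saturated_in_def subgraph_def simple_graph_def)
  then show ?thesis using E(2) by blast
qed

text \<open>The three summands count edges meeting the copy of \<open>F - W\<close>, edges lost
  while peeling, and edges among the fewer than \<open>sqrt n\<close> leftover vertices. The
  threshold \<open>a ^ D * sqrt n\<close> lets cliques of up to \<open>D\<close> vertices be found
  in every set of at least \<open>sqrt n\<close> vertices.\<close>

lemma (in maximum_class) sat_le:
  fixes G :: "'b ugraph" and a :: real
  defines "D \<equiv> card (verts F)" and "n \<equiv> card (verts G)"
  assumes G: "simple_graph G" and rich: "rich G a (a ^ D * sqrt n)" and a: "0 < a" "a \<le> 1" and n: "0 < n"
  shows "real (sat G F) \<le> (D + 2 * D / a ^ D + 1) * n"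
proof -
  have finG: "finite (verts G)" using G by (simp add: simple_graph_def)
  have subD: "a ^ D \<le> a ^ card X" "card X \<le> D" if "X \<subseteq> verts F" for X
  proof -
    show "card X \<le> D" unfolding D_def using finite_verts that by (rule card_mono)
    then show "a ^ D \<le> a ^ card X" using a by (intro power_decreasing) auto
  qed
  \<comment> \<open>Used with \<open>X = verts F - W\<close> to host the copy of
    \<open>F - W\<close>, and with \<open>X = R\<close> for the blocks.\<close>
  have ex: "\<exists>K L. block G (card X) K L \<and> K \<subseteq> U \<and> L \<subseteq> U \<and> a ^ D * real (card U) \<le> real (card L)"
    if X: "X \<subseteq> verts F" and U: "U \<subseteq> verts G" "sqrt n \<le> real (card U)" for X U
  proof -
    have "a ^ D * sqrt n \<le> a ^ card X * real (card U)"
      using subD[OF X] U a by (intro mult_mono) auto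
    from rich_block_exists[OF G rich a U(1) this] obtain K L where
      "block G (card X) K L" "K \<subseteq> U" "L \<subseteq> U" "a ^ card X * real (card U) \<le> real (card L)" by blast
    moreover have "a ^ D * real (card U) \<le> a ^ card X * real (card U)"
      using subD[OF X] by (intro mult_right_mono) auto
    ultimately show ?thesis by (meson order_trans)
  qed
  have "1 \<le> real n" using n by linarith
  then have "1 * real n \<le> real n * real n" by (intro mult_right_mono) auto
  then have "sqrt n \<le> real n" by (intro real_le_lsqrt) (auto simp: power2_eq_square)
  then obtain K\<^sub>0 L\<^sub>0 where K0: "block G (card (verts F - W)) K\<^sub>0 L\<^sub>0" "K\<^sub>0 \<subseteq> verts G"
    using ex[of "verts F - W" "verts G"] unfolding n_def by blast
  then have finK0: "finite K\<^sub>0" and cK0: "card K\<^sub>0 = card (verts F - W)"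
    and K0_edge: "\<And>x y. x \<in> K\<^sub>0 \<Longrightarrow> y \<in> K\<^sub>0 \<Longrightarrow> x \<noteq> y \<Longrightarrow> {x, y} \<in> edges G"
    by (auto simp: block_def)
  obtain g where g: "bij_betw g (verts F - W) K\<^sub>0"
    using finite_same_card_bij[OF _ finK0, of "verts F - W"] cK0 finite_verts by auto
  let ?U = "verts G - K\<^sub>0"
  have "\<exists>Ps. (\<forall>(K, L)\<in>Ps. block G (card R) K L \<and> K \<union> L \<subseteq> ?U) \<and>
      (\<forall>P\<in>Ps. \<forall>Q\<in>Ps. P \<noteq> Q \<longrightarrow> (fst P \<union> snd P) \<inter> (fst Q \<union> snd Q) = {}) \<and>
      (\<forall>E. E \<subseteq> {e. card e = 2} \<longrightarrow>
         (\<forall>(K, L)\<in>Ps. \<forall>x\<in>?U - K. card {y \<in> L. {x, y} \<in> E} \<le> D) \<longrightarrow>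
         real (card (E \<inter> Pow ?U)) \<le> 2 * D / a ^ D * card ?U + (sqrt n)\<^sup>2)"
  proof (rule block_decomposition)
    fix U assume U: "U \<subseteq> verts G" "sqrt n \<le> real (card U)"
    from ex[OF R_verts U] subD(2)[OF R_verts]
    show "\<exists>K L. block G (card R) K L \<and> finite K \<and> card K \<le> D \<and> K \<subseteq> U \<and> L \<subseteq> U \<and>
        a ^ D * real (card U) \<le> real (card L)"
      by (metis block_def)
  qed (use a n finG in auto)
  then obtain Ps where Ps: "\<forall>(K, L)\<in>Ps. block G (card R) K L \<and> K \<union> L \<subseteq> ?U"
    and disj: "\<forall>P\<in>Ps. \<forall>Q\<in>Ps. P \<noteq> Q \<longrightarrow> (fst P \<union> snd P) \<inter> (fst Q \<union> snd Q) = {}"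
    and count: "\<forall>E. E \<subseteq> {e. card e = 2} \<longrightarrow>
         (\<forall>(K, L)\<in>Ps. \<forall>x\<in>?U - K. card {y \<in> L. {x, y} \<in> E} \<le> D) \<longrightarrow>
         real (card (E \<inter> Pow ?U)) \<le> 2 * D / a ^ D * card ?U + (sqrt n)\<^sup>2"
    by (elim exE conjE)
  have Ps': "fst P \<inter> snd P = {}" "finite (fst P)" "card (fst P) = card R" "fst P \<union> snd P \<subseteq> ?U"
    "\<And>x y. x \<in> fst P \<Longrightarrow> y \<in> fst P \<union> snd P \<Longrightarrow> x \<noteq> y \<Longrightarrow> {x, y} \<in> edges G" if "P \<in> Ps" for P
    using bspec[OF Ps that] by (auto simp: block_def case_prod_unfold)
  define \<phi> where "\<phi> P = (SOME f. bij_betw f R (fst P))" for P :: "'b set \<times> 'b set"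
  have finR: "finite R" using R_verts finite_verts finite_subset by blast
  have \<phi>: "bij_betw (\<phi> P) R (fst P)" if "P \<in> Ps" for P
  proof -
    have "\<exists>f. bij_betw f R (fst P)" using finite_same_card_bij[OF finR Ps'(2)[OF that]] Ps'(3)[OF that] by simp
    then show ?thesis unfolding \<phi>_def by (rule someI_ex)
  qed
  have g_img: "g ` (verts F - W) = K\<^sub>0" and g_inj: "inj_on g (verts F - W)"
    using g by (auto simp: bij_betw_def)
  interpret block_system F k c i\<^sub>0 v g Ps \<phi>
  proof
    show "(fst P \<union> snd P) \<inter> g ` (verts F - W) = {}" if "P \<in> Ps" for P
      using Ps'(4)[OF that] g_img by blast
    show "(fst P \<union> snd P) \<inter> (fst Q \<union> snd Q) = {}" if "P \<in> Ps" "Q \<in> Ps" "P \<noteq> Q" for P Q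
      by (rule disj[rule_format, OF that])
  qed (fact g_inj \<phi> Ps'(1))+
  have base_sub: "base_edges \<subseteq> edges G"
  proof
    fix e assume e: "e \<in> base_edges"
    have ne: "x \<noteq> y" if "{x, y} \<in> edges F" for x y
      using that simple by (auto simp: simple_graph_def)
    have img: "\<exists>x y. f ` e' = {x, y}" if "e' \<in> edges F" for f :: "'a \<Rightarrow> 'b" and e'
      using that by (rule edgeE) auto
    have "\<exists>x y. e = {x, y}"
      using e unfolding base_edges_def block_edges_def
      by (elim UnE UN_E imageE CollectE exE conjE) (use img in auto)
    then obtain x y where xy: "e = {x, y}" by blast
    from e[unfolded xy] have "{x, y} \<in> edges G"
    proof (cases rule: base_edgesE)
      case (outside a b)
      then have "g a \<noteq> g b" using ne g_inj by (auto dest: inj_onD)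
      then show ?thesis using outside g_img by (auto intro!: K0_edge)
    next
      case (inner P a b)
      then have "\<phi> P a \<noteq> \<phi> P b" using ne \<phi>[OF inner(1)] by (auto simp: bij_betw_def dest: inj_onD)
      then show ?thesis using inner \<phi>_fst Ps'(5)[OF inner(1)] by auto
    next
      case (left P)
      then have "x \<noteq> y" using Ps'(1) by blast
      then show ?thesis using left Ps'(5) by auto
    next
      case (right P)
      then have "y \<noteq> x" using Ps'(1) by blast
      then have "{y, x} \<in> edges G" using right Ps'(5) by auto
      then show ?thesis by (simp add: insert_commute)
    qed
    then show "e \<in> edges G" by (simp add: xy)
  qed
  from saturated_extension_exists[OF G base_sub base_free] obtain E
    where E: "base_edges \<subseteq> E" and sat: "saturated_in (UGraph (verts G) E) G F" by blast
  let ?H = "UGraph (verts G) E"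
  have H: "simple_graph ?H" "\<not> contains_copy ?H F"
    using sat by (auto simp: saturated_in_def subgraph_def)
  have E2: "E \<subseteq> {e. card e = 2}" "E \<subseteq> Pow (verts G)" using H(1) by (auto simp: simple_graph_def)
  have finE: "finite E" using E2(2) finG by (meson finite_Pow_iff finite_subset)
  \<comment> \<open>A vertex of \<open>?U - K\<close> avoids both \<open>K\<close> and the copy of
    \<open>F - W\<close>, so more than \<open>D\<close> neighbours in \<open>L\<close> would
    complete a copy of \<open>F\<close>.\<close>
  have deg: "card {y \<in> L. {x, y} \<in> E} \<le> D" if KL: "(K, L) \<in> Ps" and x: "x \<in> ?U - K" for K L x
  proof (rule ccontr)
    assume "\<not> card {y \<in> L. {x, y} \<in> E} \<le> D"
    then have "contains_copy ?H F"
      using Ps'(4)[OF KL] x E H(1) K0(2) g_img KL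
      by (intro large_degree_creates_copy[of ?H "(K, L)" x]) (auto simp: D_def)
    with H(2) show False by contradiction
  qed
  let ?A = "(\<lambda>(x, y). {x, y}) ` (K\<^sub>0 \<times> verts G)"
  have "E \<subseteq> (E \<inter> Pow ?U) \<union> ?A"
  proof
    fix e assume e: "e \<in> E"
    then obtain x y where xy: "e = {x, y}" using E2(1) by (auto simp: card_2_iff)
    have mem: "x \<in> verts G" "y \<in> verts G" using e E2(2) xy by auto
    show "e \<in> (E \<inter> Pow ?U) \<union> ?A"
    proof (cases "e \<inter> K\<^sub>0 = {}")
      case True then show ?thesis using e xy mem by auto
    next
      case False
      then have "e \<in> ?A"
        using xy mem by (auto intro: image_eqI[of _ _ "(x, y)"] image_eqI[of _ _ "(y, x)"])
      then show ?thesis ..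
    qed
  qed
  then have "card E \<le> card ((E \<inter> Pow ?U) \<union> ?A)" using finE finK0 finG by (intro card_mono) auto
  also have "\<dots> \<le> card (E \<inter> Pow ?U) + card ?A" by (rule card_Un_le)
  also have "card ?A \<le> card (K\<^sub>0 \<times> verts G)" using finK0 finG by (intro card_image_le) auto
  also have "\<dots> = card (verts F - W) * n" by (simp add: card_cartesian_product cK0 n_def)
  also have "\<dots> \<le> D * n" using subD(2)[of "verts F - W"] by simp
  finally have "real (card E) \<le> real (card (E \<inter> Pow ?U)) + real D * real n"
    by (simp flip: of_nat_mult of_nat_add)
  also have "real (card (E \<inter> Pow ?U)) \<le> 2 * D / a ^ D * card ?U + (sqrt n)\<^sup>2"
    using deg by (intro count[rule_format] E2(1)) auto
  also have "2 * D / a ^ D * card ?U \<le> 2 * D / a ^ D * n"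
    using a finG by (intro mult_left_mono) (auto simp: n_def intro!: card_mono)
  finally have "real (card E) \<le> (real D + 2 * real D / a ^ D + 1) * n" by (simp add: algebra_simps)
  moreover have "sat G F \<le> card E" unfolding sat_def by (rule Least_le) (use sat in force)
  ultimately show ?thesis by linarith
qed

section \<open>Richness of the random graph\<close>

text \<open>The number of edges inside \<open>U\<close> is binomial with
  \<open>N = card U choose 2\<close> trials. From \<open>2 \<le> card U\<close> follows
  \<open>(card U)\<^sup>2 \<le> 4 * N\<close>, so the threshold is at most half the mean
  \<open>N * p\<close>, and Hoeffding's inequality applies with deviation
  \<open>N * p / 2\<close>.\<close>

lemma prob_few_edges_le:
  assumes p: "0 < p" "p < 1" and U: "U \<subseteq> {1..n}" "2 \<le> card U"
  shows "measure_pmf.prob (Pi_pmf (pairs n) False (\<lambda>_. bernoulli_pmf p))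
      {b. real (card {e. e \<subseteq> U \<and> card e = 2 \<and> b e}) \<le> p / 8 * (real (card U))\<^sup>2}
    \<le> exp (- (p\<^sup>2 * (real (card U))\<^sup>2 / 8))"
proof -
  let ?B = "{e. e \<subseteq> U \<and> card e = 2}" and ?u = "card U"
  define N where "N = card ?B"
  let ?M = "Pi_pmf (pairs n) False (\<lambda>_. bernoulli_pmf p)"
  have finU: "finite U" using U(1) finite_subset by blast
  have finB: "finite ?B" using finU by (auto intro: finite_subset[of _ "Pow U"])
  have sub: "?B \<subseteq> pairs n" using U(1) by (auto simp: pairs_def)
  have finP: "finite (pairs n)" by (auto simp: pairs_def intro: finite_subset[of _ "Pow {1..n}"])
  have "real N = real ?u * (real ?u - 1) / 2"
    using n_subsets[OF finU, of 2] U(2) by (simp add: N_def choose_two real_of_nat_div of_nat_diff)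
  moreover have "real ?u * 2 \<le> real ?u * real ?u" using U(2) by (intro mult_left_mono) auto
  ultimately have N4: "(real ?u)\<^sup>2 \<le> 4 * real N" by (simp add: power2_eq_square algebra_simps)
  have "0 < (real ?u)\<^sup>2" using U(2) by auto
  with N4 have N0: "0 < N" by (intro gr0I) auto
  have "binomial_pmf N p = map_pmf (\<lambda>f. card {e \<in> ?B. f e}) (Pi_pmf ?B False (\<lambda>_. bernoulli_pmf p))"
    using finB p by (intro binomial_pmf_altdef') (auto simp: N_def)
  \<comment> \<open>The product over the pairs inside \<open>U\<close> is a marginal of the product
    over all pairs.\<close>
  also have "\<dots> = map_pmf (\<lambda>b. card {e \<in> ?B. b e}) ?M"
    unfolding Pi_pmf_subset[OF finP sub] map_pmf_comp
    by (intro map_pmf_cong refl arg_cong[of _ _ card]) auto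
  finally have binom: "binomial_pmf N p = map_pmf (\<lambda>b. card {e \<in> ?B. b e}) ?M" .
  have bound: "p / 8 * (real ?u)\<^sup>2 \<le> real N * p - real N * p / 2"
    using mult_left_mono[OF N4, of "p / 8"] p by simp
  have "measure_pmf.prob ?M {b. real (card {e. e \<subseteq> U \<and> card e = 2 \<and> b e}) \<le> p / 8 * (real ?u)\<^sup>2}
      \<le> measure_pmf.prob ?M {b. real (card {e \<in> ?B. b e}) \<le> real N * p - real N * p / 2}"
    using bound by (intro measure_pmf.finite_measure_mono) (auto simp: conj_assoc)
  also have "\<dots> = measure_pmf.prob (binomial_pmf N p) {x. real x \<le> real N * p - real N * p / 2}"
    unfolding binom measure_map_pmf by (simp add: vimage_def)
  also have "\<dots> \<le> exp (- 2 * (real N * p / 2)\<^sup>2 / real N)"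
    by (rule binomial_distribution.prob_le) (use p N0 in \<open>auto simp: binomial_distribution_def\<close>)
  also have "\<dots> = exp (- (p\<^sup>2 * (4 * real N) / 8))"
    using N0 by (simp add: power2_eq_square field_simps)
  also have "\<dots> \<le> exp (- (p\<^sup>2 * (real ?u)\<^sup>2 / 8))"
    using mult_left_mono[OF N4, of "p\<^sup>2"] by (simp add: mult_ac)
  finally show ?thesis .
qed

text \<open>Counts ordered pairs and gives up the handshake factor 1/2, so that
  \<open>d = p / 8 * card U\<close> meets the threshold of \<open>prob_few_edges_le\<close>.\<close>

lemma card_edges_within_le:
  assumes "finite U" and deg: "\<And>x. x \<in> U \<Longrightarrow> real (card (nbhd G x \<inter> U)) \<le> d"
  shows "real (card {e. e \<subseteq> U \<and> card e = 2 \<and> e \<in> edges G}) \<le> real (card U) * d"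
proof -
  let ?S = "SIGMA x:U. nbhd G x \<inter> U"
  have "{e. e \<subseteq> U \<and> card e = 2 \<and> e \<in> edges G} \<subseteq> (\<lambda>(x, y). {x, y}) ` ?S"
  proof
    fix e assume e: "e \<in> {e. e \<subseteq> U \<and> card e = 2 \<and> e \<in> edges G}"
    then obtain x y where "e = {x, y}" by (auto simp: card_2_iff)
    with e show "e \<in> (\<lambda>(x, y). {x, y}) ` ?S"
      by (intro image_eqI[of _ _ "(x, y)"]) (auto simp: nbhd_def)
  qed
  then have "card {e. e \<subseteq> U \<and> card e = 2 \<and> e \<in> edges G} \<le> card ?S"
    using \<open>finite U\<close> by (intro surj_card_le) auto
  also have "\<dots> = (\<Sum>x\<in>U. card (nbhd G x \<inter> U))" using \<open>finite U\<close> by (intro card_SigmaI) auto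
  finally have "real (card {e. e \<subseteq> U \<and> card e = 2 \<and> e \<in> edges G}) \<le> (\<Sum>x\<in>U. real (card (nbhd G x \<inter> U)))"
    by (simp flip: of_nat_sum)
  also have "\<dots> \<le> real (card U) * d" using sum_bounded_above[of U, OF deg] by simp
  finally show ?thesis .
qed

text \<open>Expansion of a product of factors \<open>1 + r\<close>; it puts the union bound over
  vertex sets into closed form.\<close>

lemma sum_Pow_power_card:
  fixes r :: real
  assumes "finite A"
  shows "(\<Sum>X\<in>Pow A. r ^ card X) = (1 + r) ^ card A"
  using prod_add[OF assms, of "\<lambda>_. r" "\<lambda>_. 1"] by (simp add: add.commute)

text \<open>A set violating richness spans few edges, so a union bound over all large
  \<open>U\<close> applies. Using \<open>card U \<ge> \<delta> * sqrt n\<close> for one of the two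
  factors \<open>card U\<close> in the exponent turns each failure probability into a power
  \<open>r ^ card U\<close> with a common \<open>r\<close>.\<close>

lemma prob_not_rich_le:
  fixes \<delta> :: real
  assumes p: "0 < p" "p < 1" and \<delta>: "2 \<le> \<delta> * sqrt n"
  shows "measure_pmf.prob (gnp n p) {G. \<not> rich G (p / 8) (\<delta> * sqrt n)}
    \<le> (1 + exp (- (p\<^sup>2 * (\<delta> * sqrt n) / 8))) ^ n - 1"
proof -
  let ?M = "Pi_pmf (pairs n) False (\<lambda>_. bernoulli_pmf p)"
  let ?r = "exp (- (p\<^sup>2 * (\<delta> * sqrt n) / 8))"
  let ?\<U> = "{U. U \<subseteq> {1..n} \<and> \<delta> * sqrt n \<le> real (card U)}"
  let ?A = "\<lambda>U. {b. real (card {e. e \<subseteq> U \<and> card e = 2 \<and> b e}) \<le> p / 8 * (real (card U))\<^sup>2}"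
  have fin\<U>: "finite ?\<U>" by (auto intro: finite_subset[of _ "Pow {1..n}"])
  have "(\<lambda>b. UGraph {1..n} {e \<in> pairs n. b e}) -` {G. \<not> rich G (p / 8) (\<delta> * sqrt n)} \<subseteq> (\<Union>U\<in>?\<U>. ?A U)"
  proof
    fix b assume "b \<in> (\<lambda>b. UGraph {1..n} {e \<in> pairs n. b e}) -` {G. \<not> rich G (p / 8) (\<delta> * sqrt n)}"
    then obtain U where U: "U \<in> ?\<U>"
      and deg: "\<And>x. x \<in> U \<Longrightarrow>
        real (card (nbhd (UGraph {1..n} {e \<in> pairs n. b e}) x \<inter> U)) < p / 8 * real (card U)"
      by (auto simp: rich_def not_le)
    have "finite U" using U finite_subset[of U "{1..n}"] by auto
    from card_edges_within_le[OF this less_imp_le[OF deg]]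
    have "real (card {e. e \<subseteq> U \<and> card e = 2 \<and> e \<in> pairs n \<and> b e}) \<le> real (card U) * (p / 8 * real (card U))"
      by simp
    moreover have "{e. e \<subseteq> U \<and> card e = 2 \<and> e \<in> pairs n \<and> b e} = {e. e \<subseteq> U \<and> card e = 2 \<and> b e}"
      using U by (auto simp: pairs_def)
    ultimately have "b \<in> ?A U" by (simp add: power2_eq_square mult_ac)
    with U show "b \<in> (\<Union>U\<in>?\<U>. ?A U)" by blast
  qed
  then have "measure_pmf.prob (gnp n p) {G. \<not> rich G (p / 8) (\<delta> * sqrt n)}
      \<le> measure_pmf.prob ?M (\<Union>U\<in>?\<U>. ?A U)"
    unfolding gnp_def measure_map_pmf by (intro measure_pmf.finite_measure_mono) auto
  also have "\<dots> \<le> (\<Sum>U\<in>?\<U>. measure_pmf.prob ?M (?A U))"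
    using fin\<U> by (intro measure_pmf.finite_measure_subadditive_finite) auto
  also have "\<dots> \<le> (\<Sum>U\<in>?\<U>. ?r ^ card U)"
  proof (rule sum_mono)
    fix U assume "U \<in> ?\<U>"
    then have U: "U \<subseteq> {1..n}" "\<delta> * sqrt n \<le> real (card U)" by auto
    have "2 \<le> real (card U)" using U(2) \<delta> by linarith
    then have "2 \<le> card U" by simp
    note prob_few_edges_le[OF p U(1) this]
    also have "exp (- (p\<^sup>2 * (real (card U))\<^sup>2 / 8)) \<le> exp (real (card U) * (- (p\<^sup>2 * (\<delta> * sqrt n) / 8)))"
    proof -
      have "real (card U) * (\<delta> * sqrt n) \<le> real (card U) * real (card U)"
        using U(2) by (intro mult_left_mono) auto
      from mult_left_mono[OF this, of "p\<^sup>2"] show ?thesis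
        by (simp add: power2_eq_square mult_ac)
    qed
    also have "\<dots> = ?r ^ card U" by (rule exp_of_nat_mult)
    finally show "measure_pmf.prob ?M (?A U) \<le> ?r ^ card U" .
  qed
  \<comment> \<open>The empty set falls below the positive threshold; leaving it out gives the
    \<open>- 1\<close>, without which the bound would not tend to 0.\<close>
  also have "\<dots> \<le> (\<Sum>U\<in>Pow {1..n} - {{}}. ?r ^ card U)"
    using \<delta> by (intro sum_mono2) auto
  also have "\<dots> = (1 + ?r) ^ n - 1"
    using sum_Pow_power_card[of "{1..n}" ?r] by (subst sum_diff) auto
  finally show ?thesis .
qed

section \<open>Passage to the limit\<close>

theorem theorem1p5:
  fixes p :: real and F :: "'a ugraph"
  assumes "0 < p" and "p < 1"
    and "simple_graph F" and "no_isolated_vertices F" and "ntriangleright F"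
  shows "\<exists>C::real. C > 0 \<and>
    (\<lambda>n. measure_pmf.prob (gnp n p) {G. real (sat G F) \<le> C * real n}) \<longlonglongrightarrow> 1"
proof -
  obtain c i v where col: "proper_colouring F (chromatic_number F) c" and i: "i < chromatic_number F"
    and max: "\<forall>J\<in>optimal_colour_classes F. card J \<le> card {w \<in> verts F. c w = i}"
    and v: "v \<in> verts F - {w \<in> verts F. c w = i}" "nbhd F v \<subseteq> {w \<in> verts F. c w = i}"
    using \<open>ntriangleright F\<close> unfolding ntriangleright_def optimal_colour_classes_def by blast
  interpret maximum_class F "chromatic_number F" c i v
  proof
    fix c' assume "proper_colouring F (chromatic_number F) c'"
    then have "{w \<in> verts F. c' w = i} \<in> optimal_colour_classes F"
      using i unfolding optimal_colour_classes_def by blast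
    then show "card {w \<in> verts F. c' w = i} \<le> card {w \<in> verts F. c w = i}" using max by blast
  qed (use assms col i v in auto)
  define D where "D = card (verts F)"
  \<comment> \<open>\<open>\<delta>\<close> and \<open>C\<close> are the threshold factor and the
    constant of \<open>sat_le\<close> for \<open>a = p / 8\<close>; \<open>K\<close> is the
    resulting rate in \<open>prob_not_rich_le\<close>.\<close>
  define \<delta> where "\<delta> = (p / 8) ^ D"
  define C where "C = D + 2 * D / \<delta> + 1"
  define K where "K = p\<^sup>2 * \<delta> / 8"
  have \<delta>: "0 < \<delta>" and K: "0 < K" using assms(1) by (auto simp: \<delta>_def K_def)
  have C: "0 < C" using \<delta> by (simp add: C_def add_nonneg_pos)
  let ?P = "\<lambda>n. measure_pmf.prob (gnp n p)"
  have lower: "2 - (1 + exp (- (K * sqrt n))) ^ n \<le> ?P n {G. real (sat G F) \<le> C * real n}"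
    if n: "0 < n" "2 \<le> \<delta> * sqrt n" for n
  proof -
    have "?P n (- {G. real (sat G F) \<le> C * real n}) \<le> ?P n {G. \<not> rich G (p / 8) (\<delta> * sqrt n)}"
    \<comment> \<open>The inclusion of events is argued on the support only, where graphs are simple
      with vertex set \<open>{1..n}\<close>.\<close>
    proof (rule measure_pmf.finite_measure_mono_AE)
      show "AE G in measure_pmf (gnp n p). G \<in> - {G. real (sat G F) \<le> C * real n} \<longrightarrow>
          G \<in> {G. \<not> rich G (p / 8) (\<delta> * sqrt n)}"
      proof (rule AE_pmfI, intro impI CollectI notI)
        fix G assume G: "G \<in> set_pmf (gnp n p)" "G \<in> - {G. real (sat G F) \<le> C * real n}"
          and rich: "rich G (p / 8) (\<delta> * sqrt n)"
        have "verts G = {1..n}" "simple_graph G"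
          using G(1) unfolding gnp_def simple_graph_def pairs_def set_map_pmf by fastforce+
        then have "real (sat G F) \<le> C * real n"
          using sat_le[of G "p / 8"] rich n(1) assms(1,2) by (simp add: C_def \<delta>_def D_def)
        with G(2) show False by simp
      qed
    qed auto
    also have "\<dots> \<le> (1 + exp (- (p\<^sup>2 * (\<delta> * sqrt n) / 8))) ^ n - 1"
      using assms n(2) by (intro prob_not_rich_le)
    also have "p\<^sup>2 * (\<delta> * sqrt n) / 8 = K * sqrt n" by (simp add: K_def)
    finally show ?thesis
      using measure_pmf.prob_compl[of "{G. real (sat G F) \<le> C * real n}" "gnp n p"]
      by (simp add: Compl_eq_Diff_UNIV)
  qed
  \<comment> \<open>The power tends to 1 because \<open>n * exp (- (K * sqrt n))\<close> tends to
    0.\<close>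
  have "(\<lambda>n. 2 - (1 + exp (- (K * sqrt (real n)))) ^ n) \<longlonglongrightarrow> 1"
    using K by real_asymp
  moreover have "eventually (\<lambda>n. 0 < n \<and> 2 \<le> \<delta> * sqrt (real n)) sequentially"
    using \<delta> by (intro eventually_conj eventually_gt_at_top) real_asymp
  then have "eventually (\<lambda>n. 2 - (1 + exp (- (K * sqrt (real n)))) ^ n
      \<le> ?P n {G. real (sat G F) \<le> C * real n}) sequentially"
    by eventually_elim (use lower in blast)
  ultimately have "(\<lambda>n. ?P n {G. real (sat G F) \<le> C * real n}) \<longlonglongrightarrow> 1"
    by (rule tendsto_sandwich[rotated 2, OF _ tendsto_const]) auto
  with C show ?thesis by blast
qed

end
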